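(* Let $\alpha\in(0,\infty)$, let $f\in\mathcal{C}_\alpha$ and let $\sigma\in(0,1)$. There is a constant $c>0$ (depending on $f$ and $\sigma$) such that for every $b\in(0,1/4)$, every $\delta>0$ and every integer $n\ge 1$, $$m\{x\in[0,1] : h_{\sigma,\delta}(x)\ge n\}\ \ge\ c\,n^{-1/\alpha}.$$ Moreover, if $\alpha\ge 1$ then $h_{\sigma,\delta}$ is not integrable with respect to Lebesgue measure, i.e. $\int_0^1 h_{\sigma,\delta}\,dm=\infty$.
   Context: $m$ denotes Lebesgue measure on $[0,1]$. The class $\mathcal{C}_\alpha$. Let $\phi:[0,1]\to[0,1]$ be continuous and decreasing, $C^1$ on $(0,1)$, such that: (1) there are $c_0\in(0,\infty)$ and a $C^1$ function $g_0$ on $(0,1)$ with $g_0(t)\to0$ and $g_0'(t)=o(t^{\alpha-1})$ as $t\to0^+$ and $\phi(t)=1-c_0t^\alpha+g_0(t)$ for $t$ near $0$; (2) $\phi(1)=0$ and there are $c_1\in(0,\infty)$, $\alpha'\in(0,\alpha]$ and a $C^1$ function $g_1$ on $(0,1)$ with $g_1'(s)=o(s^{\alpha'-1})$ as $s\to0^+$ and $\phi(t)=c_1(1-t)^{\alpha'}+g_1(1-t)$ for $t$ near $1$. Put $a=\int_0^1\phi(t)\,dt\in(0,1)$. The map $f:[0,1]\to[0,1]$ is defined implicitly by $$x=\int_0^{f(x)}\phi(t)\,dt\ \ (x\le a),\qquad 1-x=\int_{f(x)}^1(1-\phi(t))\,dt\ \ (x>a).$$ $\mathcal{C}_\alpha$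 is the set of all maps $f$ obtained in this way. On $(0,a)$ one has $\frac{df}{dx}=1/\phi(f(x))$ and on $(a,1)$ one has $\frac{df}{dx}=1/(1-\phi(f(x)))$. Hyperbolic times. Let $\mathcal{S}=\{0,a,1\}$ and let $\mathrm{dist}(x,\mathcal S)$ be the Euclidean distance from $x$ to $\mathcal S$. For $\delta>0$ let $\mathrm{dist}_\delta(x,\mathcal S)=\mathrm{dist}(x,\mathcal S)$ if $\mathrm{dist}(x,\mathcal S)\le\delta$, and $\mathrm{dist}_\delta(x,\mathcal S)=1$ otherwise. For $b>0$, $\sigma\in(0,1)$, $\delta>0$, an integer $n\ge1$ is a $(\sigma,\delta)$-hyperbolic time for $x\in[0,1]\setminus\mathcal S$ if for all $1\le l\le n$ $$\prod_{j=n-l}^{n-1}\Big|\tfrac{df}{dx}(f^j(x))\Big|^{-1}\le\sigma^l\quad\text{and}\quad \mathrm{dist}_\delta(f^{n-l}(x),\mathcal S)\ge\sigma^{bl}.$$ $h_{\sigma,\delta}(x)$ is the smallest $(\sigma,\delta)$-hyperbolic time for $x$, and $h_{\sigma,\delta}(x)=\infty$ if there is none (the countable set of points whose orbit meets $\mathcal S$ is irrelevant). *)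

theory Defs
  imports "HOL-Analysis.Analysis" "HOL-Library.Landau_Symbols"
begin

text \<open>
  The generating functions of the class \<open>C\<^sub>\<alpha>\<close>. Only the restriction of \<open>\<phi>\<close> to
  \<open>[0,1]\<close> and those of \<open>g\<^sub>0\<close>, \<open>g\<^sub>1\<close> to \<open>(0,1)\<close> matter. ``Decreasing'' is
  read in the weak sense.
\<close>

definition cut_function :: "real \<Rightarrow> (real \<Rightarrow> real) \<Rightarrow> bool" where
  "cut_function \<alpha> \<phi> \<longleftrightarrow>
     \<phi> ` {0..1} \<subseteq> {0..1} \<and>
     continuous_on {0..1} \<phi> \<and>
     antimono_on {0..1} \<phi> \<and>
     \<phi> C1_differentiable_on {0<..<1} \<and>
     (\<exists>c\<^sub>0 g\<^sub>0. 0 < c\<^sub>0 \<and>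
        g\<^sub>0 C1_differentiable_on {0<..<1} \<and>
        (g\<^sub>0 \<longlongrightarrow> 0) (at_right 0) \<and>
        deriv g\<^sub>0 \<in> o[at_right 0](\<lambda>t. t powr (\<alpha> - 1)) \<and>
        (\<forall>\<^sub>F t in at_right 0. \<phi> t = 1 - c\<^sub>0 * t powr \<alpha> + g\<^sub>0 t)) \<and>
     \<phi> 1 = 0 \<and>
     (\<exists>c\<^sub>1 \<alpha>' g\<^sub>1. 0 < c\<^sub>1 \<and> 0 < \<alpha>' \<and> \<alpha>' \<le> \<alpha> \<and>
        g\<^sub>1 C1_differentiable_on {0<..<1} \<and>
        deriv g\<^sub>1 \<in> o[at_right 0](\<lambda>s. s powr (\<alpha>' - 1)) \<and>
        (\<forall>\<^sub>F t in at_left 1. \<phi> t = c\<^sub>1 * (1 - t) powr \<alpha>' + g\<^sub>1 (1 - t)))"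

definition cut_point :: "(real \<Rightarrow> real) \<Rightarrow> real" where
  "cut_point \<phi> = integral {0..1} \<phi>"

text \<open>
  The implicit definition of \<open>f\<close> from \<open>\<phi>\<close>, as a relation. For a cut function \<open>\<phi>\<close>
  it determines \<open>f\<close> uniquely on \<open>[0,1]\<close>; the values elsewhere are irrelevant.
\<close>

definition generates :: "(real \<Rightarrow> real) \<Rightarrow> (real \<Rightarrow> real) \<Rightarrow> bool" where
  "generates \<phi> f \<longleftrightarrow>
     f ` {0..1} \<subseteq> {0..1} \<and>
     (\<forall>x\<in>{0..1}. x \<le> cut_point \<phi> \<longrightarrow> x = integral {0..f x} \<phi>) \<and>
     (\<forall>x\<in>{0..1}. x > cut_point \<phi> \<longrightarrow> 1 - x = integral {f x..1} (\<lambda>t. 1 - \<phi> t))"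

text \<open>
  The class \<open>C\<^sub>\<alpha>\<close> consists of the maps \<open>f\<close> with \<open>class_C \<alpha> \<phi> f\<close> for some \<open>\<phi>\<close>.
  The witness \<open>\<phi>\<close> is kept explicit because the singular set refers to
  \<open>cut_point \<phi>\<close>.
\<close>

definition class_C :: "real \<Rightarrow> (real \<Rightarrow> real) \<Rightarrow> (real \<Rightarrow> real) \<Rightarrow> bool" where
  "class_C \<alpha> \<phi> f \<longleftrightarrow> cut_function \<alpha> \<phi> \<and> generates \<phi> f"

definition trunc_dist :: "real \<Rightarrow> real \<Rightarrow> real set \<Rightarrow> real" where
  "trunc_dist \<delta> x S = (if infdist x S \<le> \<delta> then infdist x S else 1)"

text \<open>
  If \<open>f\<^sup>j(x)\<close> is in \<open>{0, a, 1}\<close> for some \<open>j < n\<close>, then the distance condition with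
  \<open>l = n - j\<close> fails, so \<open>n\<close> is not a hyperbolic time for \<open>x\<close>. Hence the value of
  \<open>deriv f\<close> at the singular points, where it is meaningless, has no influence.
\<close>

definition hyperbolic_time ::
    "(real \<Rightarrow> real) \<Rightarrow> real \<Rightarrow> real \<Rightarrow> real \<Rightarrow> real \<Rightarrow> real \<Rightarrow> nat \<Rightarrow> bool" where
  "hyperbolic_time f a b \<sigma> \<delta> x n \<longleftrightarrow>
     n \<ge> 1 \<and>
     (\<forall>l\<in>{1..n}.
        (\<Prod>j\<in>{n - l..<n}. inverse \<bar>deriv f ((f ^^ j) x)\<bar>) \<le> \<sigma> ^ l \<and>
        trunc_dist \<delta> ((f ^^ (n - l)) x) {0, a, 1} \<ge> \<sigma> powr (b * real l))"

definition first_hyperbolic_time ::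
    "(real \<Rightarrow> real) \<Rightarrow> real \<Rightarrow> real \<Rightarrow> real \<Rightarrow> real \<Rightarrow> real \<Rightarrow> enat" where
  "first_hyperbolic_time f a b \<sigma> \<delta> x =
     (if \<exists>n. hyperbolic_time f a b \<sigma> \<delta> x n
      then enat (LEAST n. hyperbolic_time f a b \<sigma> \<delta> x n) else \<infinity>)"

end

theory Submission
  imports Defs "HOL-Real_Asymp.Real_Asymp"
begin

text \<open>
  A hyperbolic time \<open>n\<close> of \<open>x\<close> requires, through its condition for \<open>l = 1\<close>, that \<open>f\<close> expands
  by at least \<open>1 / \<sigma> > 1\<close> at the point \<open>f\<^sup>n\<^sup>-\<^sup>1(x)\<close>. But \<open>0\<close> is an indifferent fixed point: on the
  first branch the inverse derivative at \<open>x\<close> is \<open>\<phi> (f x)\<close>, which is close to \<open>1\<close> as long as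
  \<open>f x\<close> is small. So a point whose orbit stays near \<open>0\<close> up to time \<open>n - 1\<close> has no hyperbolic
  time before \<open>n\<close>, whatever \<open>b\<close> and \<open>\<delta>\<close> are, and it remains to see how many such points there
  are.

  The inverse of the first branch is \<open>\<Phi>(t) = \<integral>\<^sub>0\<^sup>t \<phi>\<close>. Since \<open>\<phi>\<close> decreases and
  \<open>\<phi>(t) \<ge> 1 - 2 c\<^sub>0 t\<^sup>\<alpha>\<close> near \<open>0\<close>, one has \<open>\<Phi>(t) \<ge> t \<phi>(t) \<ge> t (1 - 2 c\<^sub>0 t\<^sup>\<alpha>)\<close>. For small \<open>c\<close>
  the numbers \<open>z\<^sub>k = c k\<^sup>-\<^sup>1\<^sup>/\<^sup>\<alpha>\<close> then satisfy \<open>\<Phi>(z\<^sub>k) \<ge> z\<^sub>k\<^sub>+\<^sub>1\<close>, in other words \<open>f\<close> maps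
  \<open>(0, z\<^sub>k\<^sub>+\<^sub>1]\<close> into \<open>(0, z\<^sub>k]\<close> (\<open>branch_step\<close>). Hence the orbit of every point of \<open>(0, z\<^sub>n]\<close>
  stays in \<open>(0, c]\<close> up to time \<open>n - 1\<close>, and this interval has length \<open>c n\<^sup>-\<^sup>1\<^sup>/\<^sup>\<alpha>\<close>. Summing
  the tail bound over \<open>n\<close> gives the divergence of the integral when \<open>\<alpha> \<ge> 1\<close>.

  The tail sets must also be shown measurable. Away from the singular points \<open>0\<close>, \<open>a\<close>, \<open>1\<close> both \<open>f\<close>
  and its derivative are continuous, because each branch inverts a primitive of a positive
  continuous function (\<open>primitive_inverse\<close>); the positivity of \<open>\<phi>\<close> and \<open>1 - \<phi>\<close> comes from
  the prescribed asymptotics at the two endpoints.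
\<close>

section \<open>Integrating a little-o bound on a derivative\<close>

text \<open>
  The comparison functions \<open>e t\<^sup>\<alpha> - s g(t)\<close> with \<open>s = 1\<close> and \<open>s = -1\<close> vanish at \<open>0\<close> and are
  increasing near \<open>0\<close>.
\<close>

lemma abs_le_powr_of_deriv_smallo:
  fixes g :: "real \<Rightarrow> real"
  assumes \<alpha>: "0 < \<alpha>" and diff: "g C1_differentiable_on {0<..<1}"
    and lim: "(g \<longlongrightarrow> 0) (at_right 0)"
    and small: "deriv g \<in> o[at_right 0](\<lambda>t. t powr (\<alpha> - 1))"
    and e: "0 < e"
  shows "\<forall>\<^sub>F t in at_right 0. \<bar>g t\<bar> \<le> e * t powr \<alpha>"
proof -
  have gder: "(g has_real_derivative deriv g t) (at t)" if "t \<in> {0<..<1}" for t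
    using diff that by (simp add: C1_differentiable_on_eq DERIV_deriv_iff_real_differentiable)
  have "\<forall>\<^sub>F t in at_right 0. norm (deriv g t) \<le> (e * \<alpha>) * norm (t powr (\<alpha> - 1))"
    using landau_o.smallD[OF small, of "e * \<alpha>"] e \<alpha> by simp
  then obtain r where r: "0 < r"
    and rle: "\<And>t. 0 < t \<Longrightarrow> t < r \<Longrightarrow> \<bar>deriv g t\<bar> \<le> e * \<alpha> * t powr (\<alpha> - 1)"
    by (auto simp: eventually_at_right_field)
  have signed: "s * g t \<le> e * t powr \<alpha>"
    if s: "\<bar>s\<bar> = 1" and t: "0 < t" "t < min r 1" for s t :: real
  proof -
    define h where "h u = e * u powr \<alpha> - s * g u" for u
    have hder: "(h has_real_derivative e * (\<alpha> * u powr (\<alpha> - 1)) - s * deriv g u) (at u)"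
      if "0 < u" "u < min r 1" for u
      unfolding h_def using that gder[of u] by (auto intro!: derivative_eq_intros)
    have hmono: "h u \<le> h t" if u: "0 < u" "u < t" for u
    proof (rule DERIV_nonneg_imp_nondecreasing[where f = h])
      show "u \<le> t" using u by simp
      fix v assume v: "u \<le> v" "v \<le> t"
      have "s * deriv g v \<le> \<bar>deriv g v\<bar>"
        using s abs_ge_self[of "s * deriv g v"] by (simp add: abs_mult)
      also have "\<dots> \<le> e * (\<alpha> * v powr (\<alpha> - 1))" using rle[of v] u t v by (simp add: mult.assoc)
      finally have "0 \<le> e * (\<alpha> * v powr (\<alpha> - 1)) - s * deriv g v" by simp
      then show "\<exists>y. (h has_real_derivative y) (at v) \<and> 0 \<le> y"
        using hder[of v] u t v by force
    qed
    have "(h \<longlongrightarrow> e * 0 - s * 0) (at_right 0)"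
    proof -
      have "((\<lambda>u. u powr \<alpha>) \<longlongrightarrow> 0) (at_right (0::real))"
        using \<alpha> by real_asymp
      then show ?thesis unfolding h_def by (intro tendsto_intros lim)
    qed
    then have "(h \<longlongrightarrow> 0) (at_right 0)" by simp
    moreover have "\<forall>\<^sub>F u in at_right 0. h u \<le> h t"
      using hmono t by (auto simp: eventually_at_right_field)
    ultimately have "0 \<le> h t"
      by (rule tendsto_upperbound) simp
    then show ?thesis by (simp add: h_def)
  qed
  have "\<bar>g t\<bar> \<le> e * t powr \<alpha>" if "0 < t" "t < min r 1" for t
    using signed[of 1 t] signed[of "-1" t] that by auto
  then show ?thesis
    using r by (auto simp: eventually_at_right_field intro!: exI[of _ "min r 1"])
qed

section \<open>Inverting the primitive of a positive function\<close>

lemma primitive_strict_mono: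
  fixes p :: "real \<Rightarrow> real"
  assumes cont: "continuous_on {0..1} p" and pos: "\<And>t. t \<in> {0<..<1} \<Longrightarrow> 0 < p t"
  shows "strict_mono_on {0..1} (\<lambda>t. integral {0..t} p)"
proof (rule strict_mono_onI)
  fix s t :: real assume st: "s \<in> {0..1}" "t \<in> {0..1}" "s < t"
  show "integral {0..s} p < integral {0..t} p"
  proof (rule DERIV_pos_imp_increasing_open[OF \<open>s < t\<close>])
    fix u assume u: "s < u" "u < t"
    have "((\<lambda>x. integral {0..x} p) has_real_derivative p u) (at u within {0..1})"
      using u st by (intro integral_has_real_derivative cont) auto
    then have "((\<lambda>x. integral {0..x} p) has_real_derivative p u) (at u)"
      using u st by (simp add: at_within_Icc_at)
    then show "\<exists>y. ((\<lambda>x. integral {0..x} p) has_real_derivative y) (at u) \<and> 0 < y"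
      using pos[of u] u st by auto
  next
    have "continuous_on {0..1} (\<lambda>x. integral {0..x} p)"
      by (intro indefinite_integral_continuous_1 integrable_continuous_real cont)
    then show "continuous_on {s..t} (\<lambda>x. integral {0..x} p)"
      by (rule continuous_on_subset) (use st in auto)
  qed
qed

text \<open>
  Both branches of the map are instances, with \<open>p = \<phi>\<close> and with \<open>p = 1 - \<phi>\<close>. A right
  inverse of the strictly increasing primitive is automatically a left inverse, so the inverse
  function theorem applies.
\<close>

lemma primitive_inverse:
  fixes p g :: "real \<Rightarrow> real"
  assumes cont: "continuous_on {0..1} p" and pos: "\<And>t. t \<in> {0<..<1} \<Longrightarrow> 0 < p t"
    and inv: "\<And>y. y \<in> {0<..<integral {0..1} p} \<Longrightarrow> g y \<in> {0..1} \<and> y = integral {0..g y} p"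
    and y: "y \<in> {0<..<integral {0..1} p}"
  shows "g y \<in> {0<..<1}" and "(g has_real_derivative inverse (p (g y))) (at y)"
proof -
  define P where "P t = integral {0..t} p" for t
  have mono: "strict_mono_on {0..1} P"
    unfolding P_def by (rule primitive_strict_mono[OF cont pos])
  have P0: "P 0 = 0" by (simp add: P_def)
  have inj: "inj_on P {0..1}" using mono by (rule strict_mono_on_imp_inj_on)
  have g01: "g z \<in> {0..1}" and Pg: "P (g z) = z" if "z \<in> {0<..<P 1}" for z
    using inv[of z] that by (auto simp: P_def)
  have yP: "y \<in> {0<..<P 1}" using y by (simp add: P_def)
  have "g y \<noteq> 0" "g y \<noteq> 1" using Pg[OF yP] yP P0 by auto
  then show gy: "g y \<in> {0<..<1}" using g01[OF yP] by auto
  have der: "(P has_real_derivative p t) (at t)" if "t \<in> {0<..<1}" for t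
  proof -
    have "(P has_real_derivative p t) (at t within {0..1})"
      unfolding P_def using that by (intro integral_has_real_derivative cont) auto
    then show ?thesis using that by (simp add: at_within_Icc_at)
  qed
  have gP: "g (P t) = t" if t: "t \<in> {0<..<1}" for t
  proof -
    have "P 0 < P t" "P t < P 1" using t by (auto intro!: strict_mono_onD[OF mono])
    then have "P t \<in> {0<..<P 1}" using P0 by simp
    then show ?thesis using g01[of "P t"] Pg[of "P t"] t by (auto intro: inj_onD[OF inj])
  qed
  have "(g has_derivative (*) (inverse (p (g y)))) (at y)"
  proof (rule has_derivative_inverse_strong_x[where S = "{0<..<1}"])
    show "(P has_derivative (*) (p (g y))) (at (g y))"
      using der[OF gy] by (simp add: has_field_derivative_def)
    show "(*) (p (g y)) \<circ> (*) (inverse (p (g y))) = id"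
      using pos[OF gy] by (auto simp: fun_eq_iff)
    show "continuous_on {0<..<1} P"
      by (intro continuous_at_imp_continuous_on ballI) (use der DERIV_isCont in blast)
  qed (use gy gP Pg[OF yP] in auto)
  then show "(g has_real_derivative inverse (p (g y))) (at y)"
    by (simp add: has_field_derivative_def)
qed

section \<open>Hyperbolic times as a tail condition\<close>

lemma enat_le_first_hyperbolic_time_iff:
  "enat n \<le> first_hyperbolic_time f a b \<sigma> \<delta> x \<longleftrightarrow>
     (\<forall>m<n. \<not> hyperbolic_time f a b \<sigma> \<delta> x m)"
proof (cases "\<exists>m. hyperbolic_time f a b \<sigma> \<delta> x m")
  case True
  define L where "L = (LEAST m. hyperbolic_time f a b \<sigma> \<delta> x m)"
  have L: "hyperbolic_time f a b \<sigma> \<delta> x L"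
    unfolding L_def using True by (rule LeastI_ex)
  have "L \<le> m" if "hyperbolic_time f a b \<sigma> \<delta> x m" for m
    unfolding L_def using that by (rule Least_le)
  then have "n \<le> L \<longleftrightarrow> (\<forall>m<n. \<not> hyperbolic_time f a b \<sigma> \<delta> x m)"
    using L by (meson leD leI order_trans)
  then show ?thesis
    using True by (simp add: first_hyperbolic_time_def L_def)
qed (simp add: first_hyperbolic_time_def)

text \<open>The condition for \<open>l = 1\<close>: a hyperbolic time is reached by an expanding step.\<close>

lemma hyperbolic_time_last_step:
  assumes "hyperbolic_time f a b \<sigma> \<delta> x n"
  shows "1 \<le> n" and "inverse \<bar>deriv f ((f ^^ (n - 1)) x)\<bar> \<le> \<sigma>"
proof -
  show n: "1 \<le> n" using assms by (simp add: hyperbolic_time_def)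
  have "{n - 1..<n} = {n - 1}" using n by auto
  then show "inverse \<bar>deriv f ((f ^^ (n - 1)) x)\<bar> \<le> \<sigma>"
    using assms n by (auto simp: hyperbolic_time_def dest!: bspec[where x = 1])
qed

section \<open>The maps of the class\<close>

locale cut_map =
  fixes \<alpha> :: real and \<phi> f :: "real \<Rightarrow> real"
  assumes \<alpha>_pos: "0 < \<alpha>" and class_C: "class_C \<alpha> \<phi> f"
begin

abbreviation a :: real where "a \<equiv> cut_point \<phi>"

lemma cut: "cut_function \<alpha> \<phi>" and gen: "generates \<phi> f"
  using class_C by (auto simp: class_C_def)

lemma
  shows phi_cont: "continuous_on {0..1} \<phi>"
    and phi_antimono: "s \<in> {0..1} \<Longrightarrow> t \<in> {0..1} \<Longrightarrow> s \<le> t \<Longrightarrow> \<phi> t \<le> \<phi> s"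
    and phi_1: "\<phi> 1 = 0"
  using cut by (auto simp: cut_function_def monotone_on_def)

text \<open>
  Near \<open>0\<close> the remainder \<open>g\<^sub>0\<close> is absorbed into half of the main term \<open>c\<^sub>0 t\<^sup>\<alpha>\<close>. The lower
  bound controls the speed of escape from \<open>0\<close>, the upper bound gives \<open>\<phi> < 1\<close>.
\<close>

lemma phi_near_0:
  obtains C r where "0 < C" "0 < r" "r < 1"
    "\<And>t. 0 < t \<Longrightarrow> t \<le> r \<Longrightarrow> 1 - C * t powr \<alpha> \<le> \<phi> t \<and> \<phi> t < 1"
proof -
  obtain c0 g0 where c0: "0 < c0"
    and g0: "g0 C1_differentiable_on {0<..<1}" "(g0 \<longlongrightarrow> 0) (at_right 0)"
      "deriv g0 \<in> o[at_right 0](\<lambda>t. t powr (\<alpha> - 1))"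
    and eq: "\<forall>\<^sub>F t in at_right 0. \<phi> t = 1 - c0 * t powr \<alpha> + g0 t"
    using cut by (auto simp: cut_function_def)
  have "\<forall>\<^sub>F t in at_right 0. \<bar>g0 t\<bar> \<le> c0 / 2 * t powr \<alpha>"
    by (rule abs_le_powr_of_deriv_smallo[OF \<alpha>_pos g0]) (use c0 in simp)
  with eq have "\<forall>\<^sub>F t in at_right 0. 1 - 2 * c0 * t powr \<alpha> \<le> \<phi> t \<and> \<phi> t < 1"
    using eventually_at_right_less[of 0]
  proof eventually_elim
    case (elim t)
    have "0 < c0 * t powr \<alpha>" using c0 elim by simp
    then show ?case using elim by (auto simp: abs_le_iff field_simps)
  qed
  then obtain r where "0 < r"
    and "\<And>t. 0 < t \<Longrightarrow> t < r \<Longrightarrow> 1 - 2 * c0 * t powr \<alpha> \<le> \<phi> t \<and> \<phi> t < 1"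
    by (auto simp: eventually_at_right_field)
  then show thesis
    using c0 by (intro that[of "2 * c0" "min r 1 / 2"]) (auto simp: min_def split: if_splits)
qed

text \<open>
  No limit of \<open>g\<^sub>1\<close> at \<open>0\<close> is prescribed, but \<open>g\<^sub>1 \<rightarrow> 0\<close> follows from \<open>\<phi>(1) = 0\<close> and continuity.
\<close>

lemma phi_pos_near_1: "\<exists>r<1. \<forall>t\<in>{r<..<1}. 0 < \<phi> t"
proof -
  have "\<exists>c1 \<alpha>' g1. 0 < c1 \<and> 0 < \<alpha>' \<and> \<alpha>' \<le> \<alpha> \<and>
      g1 C1_differentiable_on {0<..<1} \<and>
      deriv g1 \<in> o[at_right 0](\<lambda>s. s powr (\<alpha>' - 1)) \<and>
      (\<forall>\<^sub>F t in at_left 1. \<phi> t = c1 * (1 - t) powr \<alpha>' + g1 (1 - t))"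
    using cut unfolding cut_function_def by (elim conjE)
  then obtain c1 \<alpha>' g1 where c1: "0 < c1" and \<alpha>': "0 < \<alpha>'"
    and g1: "g1 C1_differentiable_on {0<..<1}"
      "deriv g1 \<in> o[at_right 0](\<lambda>s. s powr (\<alpha>' - 1))"
    and ev: "\<forall>\<^sub>F t in at_left 1. \<phi> t = c1 * (1 - t) powr \<alpha>' + g1 (1 - t)"
    by blast
  from ev obtain r where r: "r < 1"
    and eq: "\<And>t. r < t \<Longrightarrow> t < 1 \<Longrightarrow> \<phi> t = c1 * (1 - t) powr \<alpha>' + g1 (1 - t)"
    by (auto simp: eventually_at_left_field)
  have near: "\<phi> (1 - s) = c1 * s powr \<alpha>' + g1 s" if "0 < s" "s < 1 - r" for s
    using eq[of "1 - s"] that by simp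
  have "(g1 \<longlongrightarrow> 0) (at_right 0)"
  proof -
    have "(\<phi> \<longlongrightarrow> \<phi> 1) (at_left 1)"
      using phi_cont by (rule continuous_on_Icc_at_leftD) simp
    then have "(\<phi> \<longlongrightarrow> 0) (at_left 1)" by (simp add: phi_1)
    moreover have "filterlim (\<lambda>s. 1 - s) (at_left (1::real)) (at_right 0)"
      by real_asymp
    ultimately have "((\<lambda>s. \<phi> (1 - s)) \<longlongrightarrow> 0) (at_right 0)"
      by (rule filterlim_compose)
    moreover have "((\<lambda>s. s powr \<alpha>') \<longlongrightarrow> 0) (at_right (0::real))"
      using \<alpha>' by real_asymp
    ultimately have "((\<lambda>s. \<phi> (1 - s) - c1 * s powr \<alpha>') \<longlongrightarrow> 0 - c1 * 0) (at_right 0)"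
      by (intro tendsto_intros)
    moreover have "\<forall>\<^sub>F s in at_right 0. \<phi> (1 - s) - c1 * s powr \<alpha>' = g1 s"
      using r near by (auto simp: eventually_at_right_field intro!: exI[of _ "1 - r"])
    ultimately have "(g1 \<longlongrightarrow> 0 - c1 * 0) (at_right 0)"
      by (rule Lim_transform_eventually)
    then show ?thesis by simp
  qed
  then have "\<forall>\<^sub>F s in at_right 0. \<bar>g1 s\<bar> \<le> c1 / 2 * s powr \<alpha>'"
    by (intro abs_le_powr_of_deriv_smallo \<alpha>' g1) (use c1 in simp_all)
  then obtain q where q: "0 < q"
    and small: "\<And>s. 0 < s \<Longrightarrow> s < q \<Longrightarrow> \<bar>g1 s\<bar> \<le> c1 / 2 * s powr \<alpha>'"
    by (auto simp: eventually_at_right_field)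
  have "0 < \<phi> t" if t: "max r (1 - q) < t" "t < 1" for t
  proof -
    have "0 < c1 * (1 - t) powr \<alpha>'" using c1 t by simp
    then show ?thesis using small[of "1 - t"] near[of "1 - t"] t by (auto simp: abs_le_iff)
  qed
  then show ?thesis using r q by (intro exI[of _ "max r (1 - q)"]) auto
qed

text \<open>Monotonicity carries the bounds from the endpoints to the whole interval.\<close>

lemma
  shows phi_pos: "t \<in> {0<..<1} \<Longrightarrow> 0 < \<phi> t"
    and phi_less_1: "t \<in> {0<..<1} \<Longrightarrow> \<phi> t < 1"
proof -
  assume t: "t \<in> {0<..<1}"
  obtain r where r: "r < 1" "\<And>s. s \<in> {r<..<1} \<Longrightarrow> 0 < \<phi> s"
    using phi_pos_near_1 by auto
  obtain s where s: "max r t < s" "s < 1" using r t dense[of "max r t" 1] by auto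
  have "0 < \<phi> s" using r s by auto
  also have "\<phi> s \<le> \<phi> t" using s t by (intro phi_antimono) auto
  finally show "0 < \<phi> t" .
next
  assume t: "t \<in> {0<..<1}"
  obtain C q where q: "0 < q" "\<And>s. 0 < s \<Longrightarrow> s \<le> q \<Longrightarrow> 1 - C * s powr \<alpha> \<le> \<phi> s \<and> \<phi> s < 1"
    using phi_near_0 by metis
  have "\<phi> t \<le> \<phi> (min q t)" using q t by (intro phi_antimono) auto
  also have "\<dots> < 1" using q t by auto
  finally show "\<phi> t < 1" .
qed

lemma phi_integrable: "s \<in> {0..1} \<Longrightarrow> \<phi> integrable_on {0..s}"
  by (rule integrable_continuous_real, rule continuous_on_subset[OF phi_cont]) auto

lemma integral_one_minus_phi:
  "s \<in> {0..1} \<Longrightarrow> integral {0..s} (\<lambda>t. 1 - \<phi> t) = s - integral {0..s} \<phi>"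
  by (subst integral_diff) (auto intro: phi_integrable)

lemma cut_point_in: "a \<in> {0<..<1}"
proof -
  have "integral {0..0} \<phi> < integral {0..1} \<phi>"
    by (rule strict_mono_onD[OF primitive_strict_mono[OF phi_cont phi_pos]]) auto
  moreover have "integral {0..0} (\<lambda>t. 1 - \<phi> t) < integral {0..1} (\<lambda>t. 1 - \<phi> t)"
    by (rule strict_mono_onD[OF primitive_strict_mono])
       (use phi_less_1 in \<open>auto intro!: continuous_intros phi_cont\<close>)
  ultimately show ?thesis
    using integral_one_minus_phi[of 1] by (simp add: cut_point_def)
qed

lemma f_range: "x \<in> {0..1} \<Longrightarrow> f x \<in> {0..1}"
  using gen by (auto simp: generates_def image_subset_iff)

lemma branch_0: "x \<in> {0..a} \<Longrightarrow> integral {0..f x} \<phi> = x"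
  using gen cut_point_in by (auto simp: generates_def)

text \<open>
  Shifting the second branch by \<open>a\<close> turns its defining equation, an integral up to \<open>1\<close>, into
  one from \<open>0\<close>, the form shared with the first branch.
\<close>

lemma branch_1:
  assumes x: "x \<in> {a<..1}"
  shows "integral {0..f x} (\<lambda>t. 1 - \<phi> t) = x - a"
proof -
  have fx: "f x \<in> {0..1}" using x cut_point_in by (intro f_range) auto
  have "1 - x = integral {f x..1} (\<lambda>t. 1 - \<phi> t)"
    using gen x cut_point_in by (auto simp: generates_def)
  moreover have "integral {0..f x} (\<lambda>t. 1 - \<phi> t) + integral {f x..1} (\<lambda>t. 1 - \<phi> t)
      = integral {0..1} (\<lambda>t. 1 - \<phi> t)"
    using fx by (intro Henstock_Kurzweil_Integration.integral_combine integrable_continuous_real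
        continuous_intros phi_cont) auto
  ultimately show ?thesis
    using integral_one_minus_phi[of 1] by (simp add: cut_point_def)
qed

lemma branch_0_derivative:
  assumes x: "x \<in> {0<..<a}"
  shows "f x \<in> {0<..<1}" and "(f has_real_derivative inverse (\<phi> (f x))) (at x)"
proof -
  have inv: "f y \<in> {0..1} \<and> y = integral {0..f y} \<phi>" if "y \<in> {0<..<integral {0..1} \<phi>}" for y
    using that branch_0[of y] f_range[of y] cut_point_in by (simp add: cut_point_def)
  have x': "x \<in> {0<..<integral {0..1} \<phi>}" using x by (simp add: cut_point_def)
  show "f x \<in> {0<..<1}" "(f has_real_derivative inverse (\<phi> (f x))) (at x)"
    using primitive_inverse[where g = f, OF phi_cont phi_pos inv x'] by auto
qed

lemma branch_1_derivative:
  assumes x: "x \<in> {a<..<1}"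
  shows "f x \<in> {0<..<1}" and "(f has_real_derivative inverse (1 - \<phi> (f x))) (at x)"
proof -
  have a1: "integral {0..1} (\<lambda>t. 1 - \<phi> t) = 1 - a"
    using integral_one_minus_phi[of 1] by (simp add: cut_point_def)
  have cont: "continuous_on {0..1} (\<lambda>t. 1 - \<phi> t)" by (intro continuous_intros phi_cont)
  have pos: "0 < 1 - \<phi> t" if "t \<in> {0<..<1}" for t using phi_less_1[OF that] by simp
  have inv: "f (y + a) \<in> {0..1} \<and> y = integral {0..f (y + a)} (\<lambda>t. 1 - \<phi> t)"
    if "y \<in> {0<..<integral {0..1} (\<lambda>t. 1 - \<phi> t)}" for y
    using that branch_1[of "y + a"] f_range[of "y + a"] cut_point_in a1 by simp
  have x': "x - a \<in> {0<..<integral {0..1} (\<lambda>t. 1 - \<phi> t)}" using x a1 by simp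
  note * = primitive_inverse[where g = "\<lambda>y. f (y + a)", OF cont pos inv x']
  show "f x \<in> {0<..<1}" using *(1) by simp
  have "((\<lambda>y. f (y + a)) has_real_derivative inverse (1 - \<phi> (f x))) (at (x - a))"
    using *(2) by simp
  then show "(f has_real_derivative inverse (1 - \<phi> (f x))) (at x)"
    using DERIV_shift[of f "inverse (1 - \<phi> (f x))" "x - a" a] by simp
qed

section \<open>Measurability of the tail sets\<close>

abbreviation I01 :: "real measure" where "I01 \<equiv> restrict_space borel {0..1}"

text \<open>Three exceptional points are a measurable set on which any function is measurable.\<close>

lemma measurable_off_singular_points:
  fixes g :: "real \<Rightarrow> real"
  assumes 0: "continuous_on {0<..<a} g" and 1: "continuous_on {a<..<1} g"
  shows "g \<in> borel_measurable I01"
proof (rule measurable_piecewise_restrict[where C = "{{0}, {a}, {1}, {0<..<a}, {a<..<1}}"])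
  show "space I01 \<subseteq> \<Union> {{0}, {a}, {1}, {0<..<a}, {a<..<1}}"
    by (auto simp: space_restrict_space)
  fix \<Omega> assume \<Omega>: "\<Omega> \<in> {{0}, {a}, {1}, {0<..<a}, {a<..<1}}"
  then have sub: "\<Omega> \<subseteq> {0..1}" and borel: "\<Omega> \<in> sets borel" using cut_point_in by auto
  then show "\<Omega> \<inter> space I01 \<in> sets I01"
    by (auto simp: sets_restrict_space space_restrict_space)
  have "continuous_on \<Omega> g" using \<Omega> 0 1 by auto
  then have "g \<in> borel_measurable (restrict_space borel \<Omega>)"
    by (rule borel_measurable_continuous_on_restrict)
  moreover have "restrict_space I01 \<Omega> = restrict_space borel \<Omega>"
    using sub borel by (subst restrict_restrict_space) (auto simp: Int_absorb1)
  ultimately show "g \<in> borel_measurable (restrict_space I01 \<Omega>)" by simp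
qed simp

lemma f_continuous: "continuous_on {0<..<a} f" "continuous_on {a<..<1} f"
  using DERIV_isCont[OF branch_0_derivative(2)] DERIV_isCont[OF branch_1_derivative(2)]
  by (auto intro!: continuous_at_imp_continuous_on)

lemma f_measurable: "f \<in> measurable I01 I01"
  using measurable_off_singular_points[OF f_continuous] f_range
  by (auto intro!: measurable_restrict_space2 simp: space_restrict_space)

lemma deriv_f_measurable: "deriv f \<in> borel_measurable I01"
proof (rule measurable_off_singular_points)
  have "continuous_on {0<..<a} (\<lambda>x. inverse (\<phi> (f x)))"
  proof (intro continuous_intros continuous_on_compose2[OF phi_cont] f_continuous ballI)
    show "f ` {0<..<a} \<subseteq> {0..1}" using f_range cut_point_in by auto
    show "\<phi> (f x) \<noteq> 0" if "x \<in> {0<..<a}" for x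
      using phi_pos[OF branch_0_derivative(1)[OF that]] by simp
  qed
  then show "continuous_on {0<..<a} (deriv f)"
    by (rule continuous_on_eq) (simp add: DERIV_imp_deriv[OF branch_0_derivative(2)])
  have "continuous_on {a<..<1} (\<lambda>x. inverse (1 - \<phi> (f x)))"
  proof (intro continuous_intros continuous_on_compose2[OF phi_cont] f_continuous ballI)
    show "f ` {a<..<1} \<subseteq> {0..1}" using f_range cut_point_in by auto
    show "1 - \<phi> (f x) \<noteq> 0" if "x \<in> {a<..<1}" for x
      using phi_less_1[OF branch_1_derivative(1)[OF that]] by simp
  qed
  then show "continuous_on {a<..<1} (deriv f)"
    by (rule continuous_on_eq) (simp add: DERIV_imp_deriv[OF branch_1_derivative(2)])
qed

lemma hyperbolic_time_measurable:
  "Measurable.pred I01 (\<lambda>x. hyperbolic_time f a b \<sigma> \<delta> x n)"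
proof -
  have iter [measurable]: "(\<lambda>x. (f ^^ j) x) \<in> measurable I01 I01" for j
    using measurable_compose_n[OF f_measurable] by simp
  have iter' [measurable]: "(\<lambda>x. (f ^^ j) x) \<in> borel_measurable I01" for j
    using iter by (rule measurable_compose) (simp add: measurable_restrict_space1)
  have [measurable]: "(\<lambda>x. deriv f ((f ^^ j) x)) \<in> borel_measurable I01" for j
    using iter deriv_f_measurable by (rule measurable_compose)
  have [measurable]: "(\<lambda>x. infdist x S) \<in> borel_measurable borel" for S :: "real set"
    by (intro borel_measurable_continuous_onI continuous_intros)
  show ?thesis
    unfolding hyperbolic_time_def trunc_dist_def by measurable
qed

lemma first_hyperbolic_time_measurable:
  "first_hyperbolic_time f a b \<sigma> \<delta> \<in> measurable (lebesgue_on {0..1}) (count_space UNIV)"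
proof -
  have [measurable]: "Measurable.pred (lebesgue_on {0..1}) (\<lambda>x. hyperbolic_time f a b \<sigma> \<delta> x n)"
    for n
  proof -
    have "(\<lambda>x. x) \<in> measurable lebesgue (borel :: real measure)"
      by (intro measurable_completion) simp
    then have "(\<lambda>x. x) \<in> measurable (lebesgue_on {0..1}) I01"
      by (rule measurable_restrict_space3) simp
    then show ?thesis
      using hyperbolic_time_measurable by (rule measurable_compose)
  qed
  show ?thesis
    unfolding first_hyperbolic_time_def[abs_def] by measurable
qed

section \<open>Slow escape from the indifferent fixed point\<close>

text \<open>
  By monotonicity of \<open>\<phi>\<close> the primitive at \<open>z\<close> is at least \<open>z \<phi>(z)\<close>; this replaces the exact
  integration of the expansion of \<open>\<phi>\<close>.
\<close>

lemma branch_step: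
  assumes z: "z \<in> {0<..1}" and x: "x \<in> {0<..<a}" "x \<le> z * \<phi> z"
  shows "f x \<le> z"
proof (rule ccontr)
  assume "\<not> f x \<le> z"
  then have "integral {0..z} \<phi> < integral {0..f x} \<phi>"
    using z x branch_0_derivative(1)[of x]
    by (intro strict_mono_onD[OF primitive_strict_mono[OF phi_cont phi_pos]]) auto
  also have "\<dots> = x" using x by (intro branch_0) auto
  finally have "integral {0..z} \<phi> < z * \<phi> z" using x by simp
  moreover have "integral {0..z} (\<lambda>t. \<phi> z) \<le> integral {0..z} \<phi>"
    using z by (intro integral_le phi_integrable phi_antimono) auto
  ultimately show False using z by simp
qed

end

text \<open>
  From \<open>(1 + 1/k)\<^sup>-\<^sup>\<beta> \<le> exp (-u) \<le> 1 / (1 + u)\<close> with \<open>u = \<beta> / (k + 1)\<close>, where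
  \<open>\<beta> / (2 k) \<le> u \<le> \<beta>\<close>. The constant is not sharp; only its independence of \<open>k\<close> matters.
\<close>

lemma powr_ratio_le:
  fixes \<beta> :: real
  assumes \<beta>: "0 < \<beta>" and k: "1 \<le> k"
  shows "real (Suc k) powr - \<beta> \<le> real k powr - \<beta> * (1 - \<beta> / (2 * (1 + \<beta>)) / real k)"
proof -
  define u where "u = \<beta> / (real k + 1)"
  have u: "0 < u" "u \<le> \<beta>" using \<beta> k by (auto simp: u_def field_simps)
  have "ln (real k / (real k + 1)) \<le> real k / (real k + 1) - 1"
    using k by (intro ln_le_minus_one) simp
  also have "\<dots> = - 1 / (real k + 1)" by (simp add: field_simps)
  finally have "\<beta> * ln (real k / (real k + 1)) \<le> - u"
    using mult_left_mono[of _ _ \<beta>] \<beta> by (fastforce simp: u_def)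
  then have "(real k / (real k + 1)) powr \<beta> \<le> exp (- u)"
    using k by (simp add: powr_def)
  also have "\<dots> \<le> 1 / (1 + u)"
    using exp_ge_add_one_self[of u] u by (simp add: exp_minus field_simps)
  also have "\<dots> = 1 - u / (1 + u)" using u by (simp add: field_simps)
  also have "\<dots> \<le> 1 - u / (1 + \<beta>)" using u \<beta> by (simp add: divide_left_mono)
  also have "\<dots> \<le> 1 - \<beta> / (2 * (1 + \<beta>)) / real k"
  proof -
    have "\<beta> / (2 * real k) \<le> u"
      unfolding u_def using \<beta> k by (intro divide_left_mono) auto
    then have "\<beta> / (2 * real k) / (1 + \<beta>) \<le> u / (1 + \<beta>)"
      using \<beta> by (intro divide_right_mono) auto
    then show ?thesis by (simp add: mult_ac)
  qed
  finally have "(real k / (real k + 1)) powr \<beta> \<le> 1 - \<beta> / (2 * (1 + \<beta>)) / real k" .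
  then have "real k powr - \<beta> * (real k / (real k + 1)) powr \<beta>
      \<le> real k powr - \<beta> * (1 - \<beta> / (2 * (1 + \<beta>)) / real k)"
    by (rule mult_left_mono) simp
  also have "real k powr - \<beta> * (real k / (real k + 1)) powr \<beta> = real (Suc k) powr - \<beta>"
    using k by (simp add: powr_divide powr_minus field_simps)
  finally show ?thesis .
qed

context cut_map
begin

text \<open>
  The constant \<open>c\<close> must satisfy, besides \<open>c < a\<close>, three smallness conditions: below \<open>c\<close> the expansion of \<open>\<phi>\<close> holds,
  \<open>\<phi>\<close> exceeds \<open>\<sigma>\<close>, and \<open>C c\<^sup>\<alpha>\<close> is at most the constant of the preceding lemma, which makes
  \<open>z\<^sub>k \<phi>(z\<^sub>k) \<ge> z\<^sub>k\<^sub>+\<^sub>1\<close> for \<open>z\<^sub>k = c k\<^sup>-\<^sup>1\<^sup>/\<^sup>\<alpha>\<close>.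
\<close>

lemma escape_scale:
  assumes \<sigma>: "\<sigma> < 1"
  obtains c where "0 < c" "c < a" "\<And>t. t \<in> {0<..c} \<Longrightarrow> \<sigma> < \<phi> t"
    "\<And>k. 1 \<le> k \<Longrightarrow> c * real (Suc k) powr (- 1 / \<alpha>)
        \<le> c * real k powr (- 1 / \<alpha>) * \<phi> (c * real k powr (- 1 / \<alpha>))"
proof -
  obtain C r where C: "0 < C" and r: "0 < r" "r < 1"
    and low: "\<And>t. 0 < t \<Longrightarrow> t \<le> r \<Longrightarrow> 1 - C * t powr \<alpha> \<le> \<phi> t \<and> \<phi> t < 1"
    using phi_near_0 by metis
  define \<beta> where "\<beta> = 1 / \<alpha>"
  define q where "q = \<beta> / (2 * (1 + \<beta>))"
  have \<beta>: "0 < \<beta>" using \<alpha>_pos by (simp add: \<beta>_def)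
  have q: "0 < q" using \<beta> by (simp add: q_def)
  define c where "c = Min {a / 2, r, (q / C) powr \<beta>, ((1 - \<sigma>) / (2 * C)) powr \<beta>}"
  have c0: "0 < c" using C r q cut_point_in \<sigma> by (simp add: c_def)
  have ca: "c < a" using cut_point_in by (auto simp: c_def min_less_iff_disj)
  have cr: "c \<le> r" by (simp add: c_def)
  have c_powr: "c powr \<alpha> \<le> y" if "c \<le> y powr \<beta>" "0 < y" for y
  proof -
    have "c powr \<alpha> \<le> (y powr \<beta>) powr \<alpha>" using that c0 \<alpha>_pos by (intro powr_mono2) auto
    also have "\<dots> = y" using that \<alpha>_pos by (simp add: powr_powr \<beta>_def)
    finally show ?thesis .
  qed
  have "c powr \<alpha> \<le> q / C" by (rule c_powr) (use C q in \<open>auto simp: c_def\<close>)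
  then have cq: "C * c powr \<alpha> \<le> q" using C by (simp add: field_simps)
  have "c powr \<alpha> \<le> (1 - \<sigma>) / (2 * C)" by (rule c_powr) (use C \<sigma> in \<open>auto simp: c_def\<close>)
  then have "C * c powr \<alpha> \<le> (1 - \<sigma>) / 2" using C by (simp add: field_simps)
  then have c\<sigma>: "C * c powr \<alpha> < 1 - \<sigma>" using \<sigma> by argo
  show thesis
  proof (rule that[OF c0 ca])
    fix t assume t: "t \<in> {0<..c}"
    have "C * t powr \<alpha> \<le> C * c powr \<alpha>" using t C \<alpha>_pos by (auto intro!: powr_mono2)
    then show "\<sigma> < \<phi> t" using low[of t] t cr c\<sigma> by auto
  next
    fix k :: nat assume k: "1 \<le> k"
    define z where "z = c * real k powr - \<beta>"
    have "real k powr - \<beta> \<le> 1" using k \<beta> powr_mono[of "- \<beta>" 0 "real k"] by simp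
    then have z: "0 < z" "z \<le> r" using c0 k cr by (auto simp: z_def intro: order_trans[OF mult_left_le])
    have "z powr \<alpha> = c powr \<alpha> / real k"
    proof -
      have "(real k powr - \<beta>) powr \<alpha> = real k powr - 1"
        unfolding powr_powr using \<alpha>_pos by (simp add: \<beta>_def)
      moreover have "z powr \<alpha> = c powr \<alpha> * (real k powr - \<beta>) powr \<alpha>"
        unfolding z_def by (rule powr_mult)
      ultimately show ?thesis using k by (simp only: powr_minus_divide) simp
    qed
    then have "C * z powr \<alpha> \<le> q / real k"
      using cq k by (simp add: divide_right_mono)
    then have "1 - q / real k \<le> \<phi> z" using low[of z] z by auto
    have "c * real (Suc k) powr - \<beta> \<le> c * (real k powr - \<beta> * (1 - q / real k))"
      unfolding q_def using powr_ratio_le[OF \<beta> k] c0 by (intro mult_left_mono) auto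
    also have "\<dots> = z * (1 - q / real k)" by (simp add: z_def)
    also have "\<dots> \<le> z * \<phi> z" using z \<open>1 - q / real k \<le> \<phi> z\<close> by (intro mult_left_mono) auto
    finally show "c * real (Suc k) powr (- 1 / \<alpha>)
        \<le> c * real k powr (- 1 / \<alpha>) * \<phi> (c * real k powr (- 1 / \<alpha>))"
      by (simp add: z_def \<beta>_def)
  qed
qed

text \<open>
  An orbit started in \<open>(0, z\<^sub>n]\<close> climbs the scale \<open>z\<^sub>n, z\<^sub>n\<^sub>-\<^sub>1, \<dots>, z\<^sub>1 = c\<close> at most one index per
  step. At every time \<open>m < n\<close> it is thus still in \<open>(0, c]\<close>, where \<open>\<phi> > \<sigma>\<close>, and this value of
  \<open>\<phi>\<close> is the inverse derivative of \<open>f\<close> at the point before.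
\<close>

lemma first_hyperbolic_time_late:
  assumes \<sigma>: "\<sigma> < 1"
  obtains c where "0 < c" "c < 1"
    "\<And>b \<delta> n x. 1 \<le> n \<Longrightarrow> x \<in> {0<..c * real n powr (- 1 / \<alpha>)} \<Longrightarrow>
       enat n \<le> first_hyperbolic_time f a b \<sigma> \<delta> x"
proof -
  obtain c where c0: "0 < c" and ca: "c < a" and c\<sigma>: "\<And>t. t \<in> {0<..c} \<Longrightarrow> \<sigma> < \<phi> t"
    and c_step: "\<And>k. 1 \<le> k \<Longrightarrow> c * real (Suc k) powr (- 1 / \<alpha>)
        \<le> c * real k powr (- 1 / \<alpha>) * \<phi> (c * real k powr (- 1 / \<alpha>))"
    using escape_scale[OF \<sigma>] by blast
  define z where "z k = c * real k powr (- 1 / \<alpha>)" for k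
  have z0: "0 < z k" and zc: "z k \<le> c" if "1 \<le> k" for k
    using that c0 \<alpha>_pos powr_mono[of "- 1 / \<alpha>" 0 "real k"] by (auto simp: z_def)
  have step: "f x \<in> {0<..z k}" if k: "1 \<le> k" and x: "x \<in> {0<..z (Suc k)}" for k x
  proof -
    have x': "x \<in> {0<..<a}" using x zc[of "Suc k"] ca by auto
    moreover have "z k \<in> {0<..1}" using z0[OF k] zc[OF k] ca cut_point_in by auto
    moreover have "x \<le> z k * \<phi> (z k)" using c_step[OF k] x by (simp add: z_def)
    ultimately show ?thesis using branch_step branch_0_derivative(1) by auto
  qed
  have orbit: "(f ^^ j) x \<in> {0<..z (n - j)}" if "j < n" "x \<in> {0<..z n}" for n j x
    using that
  proof (induction j)
    case (Suc j)
    then show ?case using step[of "n - Suc j" "(f ^^ j) x"] by (simp add: Suc_diff_Suc)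
  qed simp
  have "\<not> hyperbolic_time f a b \<sigma> \<delta> x m" if x: "x \<in> {0<..z n}" and m: "m < n" for b \<delta> n x m
  proof
    assume hyp: "hyperbolic_time f a b \<sigma> \<delta> x m"
    note m1 = hyperbolic_time_last_step(1)[OF hyp]
    define y where "y = (f ^^ (m - 1)) x"
    have "m - 1 < n" "1 \<le> n - (m - 1)" using m by auto
    then have y: "y \<in> {0<..<a}"
      using orbit[OF _ x, of "m - 1"] zc[of "n - (m - 1)"] ca unfolding y_def by fastforce
    have "f y = (f ^^ m) x" using m1 by (cases m) (auto simp: y_def)
    moreover have "1 \<le> n - m" using m by simp
    ultimately have fy: "f y \<in> {0<..c}" using orbit[OF m x] zc[of "n - m"] by simp
    have "inverse \<bar>deriv f y\<bar> = \<phi> (f y)"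
      using DERIV_imp_deriv[OF branch_0_derivative(2)[OF y]] phi_pos[OF branch_0_derivative(1)[OF y]]
      by simp
    then show False
      using hyperbolic_time_last_step(2)[OF hyp] c\<sigma>[OF fy] by (simp add: y_def)
  qed
  then show thesis
    using c0 ca cut_point_in
    by (intro that[of c]) (auto simp: enat_le_first_hyperbolic_time_iff z_def)
qed

end

section \<open>Tail bound and non-integrability\<close>

theorem theorem1:
  fixes \<alpha> \<sigma> :: real and \<phi> f :: "real \<Rightarrow> real"
  assumes "0 < \<alpha>" and "class_C \<alpha> \<phi> f" and "0 < \<sigma>" and "\<sigma> < 1"
  shows "(\<exists>c>0. \<forall>b\<in>{0<..<1/4}. \<forall>\<delta>>0. \<forall>n\<ge>1.
            measure (lebesgue_on {0..1})
              {x\<in>{0..1}. first_hyperbolic_time f (cut_point \<phi>) b \<sigma> \<delta> x \<ge> enat n}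
            \<ge> c * real n powr (- 1 / \<alpha>)) \<and>
         (\<alpha> \<ge> 1 \<longrightarrow> (\<forall>b\<in>{0<..<1/4}. \<forall>\<delta>>0.
            (\<integral>\<^sup>+ x. ennreal_of_enat (first_hyperbolic_time f (cut_point \<phi>) b \<sigma> \<delta> x)
               \<partial>lebesgue_on {0..1}) = \<infinity>))"
proof -
  interpret cut_map \<alpha> \<phi> f by unfold_locales (fact assms)+
  obtain c where c: "0 < c" "c < 1"
    and late: "\<And>b \<delta> n x. 1 \<le> n \<Longrightarrow> x \<in> {0<..c * real n powr (- 1 / \<alpha>)} \<Longrightarrow>
       enat n \<le> first_hyperbolic_time f (cut_point \<phi>) b \<sigma> \<delta> x"
    using first_hyperbolic_time_late[OF \<open>\<sigma> < 1\<close>] by blast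
  let ?h = "\<lambda>b \<delta>. first_hyperbolic_time f (cut_point \<phi>) b \<sigma> \<delta>"
  have tail: "ennreal (c * real n powr (- 1 / \<alpha>))
      \<le> emeasure (lebesgue_on {0..1}) {x\<in>{0..1}. enat n \<le> ?h b \<delta> x}"
    if n: "1 \<le> n" for b \<delta> n
  proof -
    let ?z = "c * real n powr (- 1 / \<alpha>)"
    have "real n powr (- 1 / \<alpha>) \<le> 1"
      using n \<open>0 < \<alpha>\<close> powr_mono[of "- 1 / \<alpha>" 0 "real n"] by simp
    then have z: "0 \<le> ?z" "?z \<le> 1" using c by (auto intro: mult_le_one)
    then have "ennreal ?z = emeasure (lebesgue_on {0..1}) {0<..?z}"
      by (subst emeasure_restrict_space) auto
    also have "\<dots> \<le> emeasure (lebesgue_on {0..1}) {x\<in>{0..1}. enat n \<le> ?h b \<delta> x}"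
    proof (rule emeasure_mono)
      show "{0<..?z} \<subseteq> {x\<in>{0..1}. enat n \<le> ?h b \<delta> x}" using late[OF n] z by auto
      have "?h b \<delta> -` {enat n..} \<inter> space (lebesgue_on {0..1}) \<in> sets (lebesgue_on {0..1})"
        using first_hyperbolic_time_measurable by (rule measurable_sets) simp
      also have "?h b \<delta> -` {enat n..} \<inter> space (lebesgue_on {0..1})
          = {x\<in>{0..1}. enat n \<le> ?h b \<delta> x}" by auto
      finally show "{x\<in>{0..1}. enat n \<le> ?h b \<delta> x} \<in> sets (lebesgue_on {0..1})" .
    qed
    finally show ?thesis .
  qed
  have finite: "emeasure (lebesgue_on {0..1}) A \<noteq> \<infinity>" for A :: "real set"
  proof -
    have "emeasure (lebesgue_on {0..1}) A \<le> emeasure (lebesgue_on {0..1}) (space (lebesgue_on {0..1::real}))"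
      by (rule emeasure_space)
    also have "\<dots> = 1" by (simp add: emeasure_restrict_space)
    finally show ?thesis by (auto simp: top_unique)
  qed
  have "c * real n powr (- 1 / \<alpha>)
      \<le> measure (lebesgue_on {0..1}) {x\<in>{0..1}. enat n \<le> ?h b \<delta> x}" if "1 \<le> n" for b \<delta> n
    using tail[OF that, of b \<delta>] finite
    by (simp add: emeasure_eq_ennreal_measure)
  moreover have "(\<integral>\<^sup>+ x. ennreal_of_enat (?h b \<delta> x) \<partial>lebesgue_on {0..1}) = \<infinity>"
    if "1 \<le> \<alpha>" for b \<delta>
  proof -
    have "ennreal (c * inverse (real (Suc n)))
        \<le> emeasure (lebesgue_on {0..1}) {x \<in> space (lebesgue_on {0..1}). enat n < ?h b \<delta> x}" for n
    proof -
      have "real (Suc n) powr - 1 \<le> real (Suc n) powr (- 1 / \<alpha>)"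
        using that by (intro powr_mono) (auto simp: field_simps)
      then have "ennreal (c * inverse (real (Suc n))) \<le> ennreal (c * real (Suc n) powr (- 1 / \<alpha>))"
        using c by (intro ennreal_leI mult_left_mono) (auto simp: powr_minus)
      also have "\<dots> \<le> emeasure (lebesgue_on {0..1}) {x\<in>{0..1}. enat (Suc n) \<le> ?h b \<delta> x}"
        by (rule tail) simp
      finally show ?thesis by (simp add: Suc_ile_eq)
    qed
    then have "(\<Sum>n. ennreal (c * inverse (real (Suc n))))
        \<le> (\<Sum>n. emeasure (lebesgue_on {0..1}) {x \<in> space (lebesgue_on {0..1}). enat n < ?h b \<delta> x})"
      by (intro suminf_le) auto
    also have "\<dots> = (\<integral>\<^sup>+ x. ennreal_of_enat (?h b \<delta> x) \<partial>lebesgue_on {0..1})"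
      by (rule nn_integral_enat_function[OF first_hyperbolic_time_measurable, symmetric])
    finally have "(\<Sum>n. ennreal (c * inverse (real (Suc n))))
        \<le> (\<integral>\<^sup>+ x. ennreal_of_enat (?h b \<delta> x) \<partial>lebesgue_on {0..1})" .
    moreover have "(\<Sum>n. ennreal (c * inverse (real (Suc n)))) = \<infinity>"
    proof (rule ccontr)
      assume "(\<Sum>n. ennreal (c * inverse (real (Suc n)))) \<noteq> \<infinity>"
      then have "summable (\<lambda>n. c * inverse (real (Suc n)))"
        using c by (intro summable_suminf_not_top) auto
      then have "summable (\<lambda>n. inverse (real (Suc n)))" using c by (simp add: summable_cmult_iff)
      then have "summable (\<lambda>n. inverse (real n))" by (subst (asm) summable_Suc_iff)
      then show False using not_summable_harmonic[where 'a = real] by simp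
    qed
    ultimately show ?thesis by (simp add: top_unique)
  qed
  ultimately show ?thesis using c by blast
qed

end
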